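(* Let $H$ be a complex Hilbert space, let $T=\begin{pmatrix}A&B\\ C&-A^*\end{pmatrix}$ be a nonnegative diagonally $p$-dominant Hamiltonian in $H\times H$ with $p<1$, and let $A$ be sectorially dichotomous with angle $\theta\in[0,\pi/2[$. Let $H\times H=V_+\oplus V_-$ be the decomposition corresponding to the dichotomy of $T$. Then $V_+$ and $V_-$ are hypermaximal $J_1$-neutral, $V_+$ is $J_2$-nonnegative, and $V_-$ is $J_2$-nonpositive.
   Context: $\mathcal D(\cdot)$ is the domain, $\varrho(\cdot)$ the resolvent set, $\sigma(\cdot)$ the spectrum; $\mathbb C_\pm$ are the open right/left half-planes. Subordination: $R$ is $p$-subordinate to $S$, $p\in[0,1]$, if $\mathcal D(S)\subset\mathcal D(R)$ and there is $c\ge0$ with $\|Rx\|\le c\|x\|^{1-p}\|Sx\|^p$ for all $x\in\mathcal D(S)$. Hamiltonian: $T=\begin{pmatrix}A&B\\ C&-A^*\end{pmatrix}$ in $H\times H$ with $A,B,C$ densely defined linear operators in $H$, $A$ closed, and $B,C$ symmetric. It is nonnegative if $B$ and $C$ are nonnegative. It is diagonally $p$-dominant if $C$ is $p$-subordinate to $A$ and $B$ is $p$-subordinate to $A^*$; then $\mathcal D(T)=\mathcal D(A)\times\mathcal D(A^* )$. Sectorial: a densely defined linear operator $S$ is sectorial with angle $\theta\in[0,\pi[$ if $\sigma(S)\subset\Sigma_\theta:=\{z:|\arg z|\le\theta\}$ (with $-\pi<\arg z\le\pi$, $\arg0=0$) and for every $\theta'\in\,]\theta,\pi]$ there is $M>0$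 with $\|(S-z)^{-1}\|\le M/|z|$ for $|\arg z|\ge\theta'$, $|z|>0$. Dichotomous: a densely defined linear operator $S$ on a Banach space $V$ is dichotomous if there exist $h>0$ and complementary closed subspaces $V=V_+\oplus V_-$ with (a) $\{z:|\operatorname{Re}z|<h\}\subset\varrho(S)$; (b) $S(\mathcal D(S)\cap V_\pm)\subset V_\pm$; (c) $\sigma(S|_{V_+})\subset\mathbb C_+$, $\sigma(S|_{V_-})\subset\mathbb C_-$. $P_\pm$ are the projections onto $V_\pm$ along $V_\mp$; $S_\pm=S|_{V_\pm}$. $S$ is sectorially dichotomous with angle $\theta\in[0,\pi/2[$ if it is dichotomous and $S_+$ and $-S_-$ are sectorial with angle $\theta$. Under the hypotheses of the claim, another theorem of the paper states that $T$ is dichotomous, with decomposition $H\times H=V_+\oplus V_-$ whose projections satisfy $\frac1{\pi\mathrm i}\int_{\mathrm i\mathbb R}'(T-z)^{-1}x\,dz=P_+x-P_-x$ for all $x\in H\times H$, where $\int'_{\mathrm i\mathbb R}=\lim_{\rho\to\infty}\int_{-\mathrm i\rho}^{\mathrm i\rho}$; this is the decomposition meant. Indefinite inner products on $H\times H$: $[x|y]_j=(J_jx|y)$, $j=1,2$, with $J_1=\begin{pmatrix}0&-\mathrm iI\\ \mathrm iI&0\end{pmatrix}$, $J_2=\begin{pmatrix}0&I\\ I&0\end{pmatrix}$. A subspace $U$ is $J_j$-nonnegative (nonpositive, neutral) if $[x|x]_j\ge0$ ($\le0$, $=0$) for all $x\in U$; it is hypermaximal $J_j$-neutral if $U=\{x\in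 H\times H:[x|y]_j=0\text{ for all }y\in U\}$. *)

theory Defs
  imports "HOL-Analysis.Analysis"
begin

section \<open>Complex Hilbert spaces\<close>

class complex_normed_vector = real_normed_vector +
  fixes scaleC :: "complex \<Rightarrow> 'a \<Rightarrow> 'a"  (infixr "*\<^sub>C" 75)
  assumes scaleC_add_right: "a *\<^sub>C (x + y) = a *\<^sub>C x + a *\<^sub>C y"
    and scaleC_add_left: "(a + b) *\<^sub>C x = a *\<^sub>C x + b *\<^sub>C x"
    and scaleC_scaleC: "a *\<^sub>C (b *\<^sub>C x) = (a * b) *\<^sub>C x"
    and scaleC_of_real: "complex_of_real r *\<^sub>C x = r *\<^sub>R x"
    and norm_scaleC: "norm (a *\<^sub>C x) = cmod a * norm x"

text \<open>The inner product is linear in the first and conjugate linear in the second argument.\<close>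

class complex_inner = complex_normed_vector +
  fixes cinner :: "'a \<Rightarrow> 'a \<Rightarrow> complex"
  assumes cinner_commute: "cinner x y = cnj (cinner y x)"
    and cinner_add_left: "cinner (x + y) z = cinner x z + cinner y z"
    and cinner_scaleC_left: "cinner (a *\<^sub>C x) y = a * cinner x y"
    and cinner_self: "cinner x x = complex_of_real ((norm x)\<^sup>2)"

class chilbert_space = complex_inner + complete_space

lemma scaleC_one: "1 *\<^sub>C x = (x :: 'a::complex_normed_vector)"
  using scaleC_of_real[of 1 x] by simp

interpretation complex_vs: vector_space "scaleC :: complex \<Rightarrow> 'a \<Rightarrow> 'a::complex_normed_vector"
  by unfold_locales
    (simp_all add: scaleC_add_right scaleC_add_left scaleC_scaleC scaleC_one)

abbreviation csubspace :: "'a::complex_normed_vector set \<Rightarrow> bool"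
  where "csubspace \<equiv> module.subspace scaleC"

instantiation prod :: (complex_inner, complex_inner) complex_inner
begin

definition scaleC_prod :: "complex \<Rightarrow> 'a \<times> 'b \<Rightarrow> 'a \<times> 'b"
  where "scaleC_prod a x = (a *\<^sub>C fst x, a *\<^sub>C snd x)"

definition cinner_prod :: "'a \<times> 'b \<Rightarrow> 'a \<times> 'b \<Rightarrow> complex"
  where "cinner_prod x y = cinner (fst x) (fst y) + cinner (snd x) (snd y)"

instance
proof
  fix a b :: complex and r :: real and x y z :: "'a \<times> 'b"
  show "a *\<^sub>C (x + y) = a *\<^sub>C x + a *\<^sub>C y"
    by (simp add: scaleC_prod_def scaleC_add_right)
  show "(a + b) *\<^sub>C x = a *\<^sub>C x + b *\<^sub>C x"
    by (simp add: scaleC_prod_def scaleC_add_left)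
  show "a *\<^sub>C (b *\<^sub>C x) = (a * b) *\<^sub>C x"
    by (simp add: scaleC_prod_def scaleC_scaleC)
  show "complex_of_real r *\<^sub>C x = r *\<^sub>R x"
    by (simp add: scaleC_prod_def scaleC_of_real prod_eq_iff)
  show "norm (a *\<^sub>C x) = cmod a * norm x"
    by (simp add: scaleC_prod_def norm_prod_def norm_scaleC power_mult_distrib
        real_sqrt_mult flip: distrib_left)
  show "cinner x y = cnj (cinner y x)"
    using cinner_commute[of "fst x" "fst y"] cinner_commute[of "snd x" "snd y"]
    by (simp add: cinner_prod_def)
  show "cinner (x + y) z = cinner x z + cinner y z"
    by (simp add: cinner_prod_def cinner_add_left)
  show "cinner (a *\<^sub>C x) y = a * cinner x y"
    by (simp add: cinner_prod_def scaleC_prod_def cinner_scaleC_left distrib_left)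
  show "cinner x x = complex_of_real ((norm x)\<^sup>2)"
    by (simp add: cinner_prod_def cinner_self norm_prod_def)
qed

end

instance prod :: (chilbert_space, chilbert_space) chilbert_space ..


section \<open>Unbounded operators\<close>

text \<open>
  An operator is a domain together with a function; the values of the function outside the
  domain are irrelevant. The space \<open>V\<close> in which an operator acts is an explicit argument where
  it matters, since restrictions to closed subspaces have to be treated as operators in those
  subspaces; \<open>UNIV\<close> is the whole space.
\<close>

datatype 'a operator = Operator (dom: "'a set") (app: "'a \<Rightarrow> 'a")

definition linear_operator :: "'a::complex_normed_vector set \<Rightarrow> 'a operator \<Rightarrow> bool" where
  "linear_operator V S \<longleftrightarrow> csubspace (dom S) \<and> dom S \<subseteq> V \<and> app S ` dom S \<subseteq> V \<and>
     (\<forall>x\<in>dom S. \<forall>y\<in>dom S. app S (x + y) = app S x + app S y) \<and>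
     (\<forall>a. \<forall>x\<in>dom S. app S (a *\<^sub>C x) = a *\<^sub>C app S x)"

definition densely_defined :: "'a::complex_normed_vector set \<Rightarrow> 'a operator \<Rightarrow> bool" where
  "densely_defined V S \<longleftrightarrow> V \<subseteq> closure (dom S)"

definition closed_operator :: "'a::complex_normed_vector operator \<Rightarrow> bool" where
  "closed_operator S \<longleftrightarrow> closed {(x, app S x) | x. x \<in> dom S}"

definition restrict_operator :: "'a operator \<Rightarrow> 'a set \<Rightarrow> 'a operator" where
  "restrict_operator S U = Operator (dom S \<inter> U) (app S)"

definition neg_operator :: "'a::complex_normed_vector operator \<Rightarrow> 'a operator" where
  "neg_operator S = Operator (dom S) (\<lambda>x. - app S x)"

definition adjoint_operator :: "'a::complex_inner operator \<Rightarrow> 'a operator" where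
  "adjoint_operator S = Operator
     {y. \<exists>z. \<forall>x\<in>dom S. cinner (app S x) y = cinner x z}
     (\<lambda>y. THE z. \<forall>x\<in>dom S. cinner (app S x) y = cinner x z)"

definition symmetric_operator :: "'a::complex_inner operator \<Rightarrow> bool" where
  "symmetric_operator S \<longleftrightarrow>
     (\<forall>x\<in>dom S. \<forall>y\<in>dom S. cinner (app S x) y = cinner x (app S y))"

definition nonnegative_operator :: "'a::complex_inner operator \<Rightarrow> bool" where
  "nonnegative_operator S \<longleftrightarrow> (\<forall>x\<in>dom S. cinner (app S x) x \<in> \<real>\<^sub>\<ge>\<^sub>0)"

text \<open>In the following definition \<open>0 powr 0 = 0\<close> has to be avoided, since \<open>0\<^sup>0 = 1\<close> is meant:
  \<open>0\<close>-subordinate is \<open>\<parallel>R x\<parallel> \<le> c \<parallel>x\<parallel>\<close> and \<open>1\<close>-subordinate is \<open>\<parallel>R x\<parallel> \<le> c \<parallel>S x\<parallel>\<close>.\<close>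

definition rpow :: "real \<Rightarrow> real \<Rightarrow> real" where
  "rpow a q = (if q = 0 then 1 else a powr q)"

definition subordinate :: "real \<Rightarrow> 'a::complex_normed_vector operator \<Rightarrow> 'a operator \<Rightarrow> bool" where
  "subordinate p R S \<longleftrightarrow> 0 \<le> p \<and> p \<le> 1 \<and> dom S \<subseteq> dom R \<and>
     (\<exists>c\<ge>0. \<forall>x\<in>dom S.
        norm (app R x) \<le> c * rpow (norm x) (1 - p) * rpow (norm (app S x)) p)"


section \<open>Resolvent, spectrum, sectorial and dichotomous operators\<close>

definition resolvent :: "'a::complex_normed_vector operator \<Rightarrow> complex \<Rightarrow> 'a \<Rightarrow> 'a" where
  "resolvent S z = inv_into (dom S) (\<lambda>x. app S x - z *\<^sub>C x)"

definition resolvent_set :: "'a::complex_normed_vector set \<Rightarrow> 'a operator \<Rightarrow> complex set" where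
  "resolvent_set V S = {z. bij_betw (\<lambda>x. app S x - z *\<^sub>C x) (dom S) V \<and>
     (\<exists>K. \<forall>y\<in>V. norm (resolvent S z y) \<le> K * norm y)}"

definition spectrum :: "'a::complex_normed_vector set \<Rightarrow> 'a operator \<Rightarrow> complex set" where
  "spectrum V S = - resolvent_set V S"

text \<open>The norm of a bounded operator on the subspace \<open>V\<close>; for \<open>V = UNIV\<close> this is \<open>onorm\<close>.\<close>

definition onorm_on :: "'a::complex_normed_vector set \<Rightarrow> ('a \<Rightarrow> 'a) \<Rightarrow> real" where
  "onorm_on V R = (SUP y\<in>V. norm (R y) / norm y)"

definition sectorial :: "'a::complex_normed_vector set \<Rightarrow> real \<Rightarrow> 'a operator \<Rightarrow> bool" where
  "sectorial V \<theta> S \<longleftrightarrow> 0 \<le> \<theta> \<and> \<theta> < pi \<and>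
     linear_operator V S \<and> densely_defined V S \<and>
     spectrum V S \<subseteq> {z. \<bar>Arg z\<bar> \<le> \<theta>} \<and>
     (\<forall>\<theta>'. \<theta> < \<theta>' \<and> \<theta>' \<le> pi \<longrightarrow>
        (\<exists>M>0. \<forall>z. z \<noteq> 0 \<and> \<theta>' \<le> \<bar>Arg z\<bar> \<longrightarrow> onorm_on V (resolvent S z) \<le> M / cmod z))"

definition complementary_subspaces :: "'a::complex_normed_vector set \<Rightarrow> 'a set \<Rightarrow> bool" where
  "complementary_subspaces U W \<longleftrightarrow> csubspace U \<and> closed U \<and> csubspace W \<and> closed W \<and>
     U \<inter> W = {0} \<and> {u + w | u w. u \<in> U \<and> w \<in> W} = UNIV"

text \<open>The projection onto \<open>U\<close> along \<open>W\<close>.\<close>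

definition projection :: "'a::complex_normed_vector set \<Rightarrow> 'a set \<Rightarrow> 'a \<Rightarrow> 'a" where
  "projection U W x = (THE u. u \<in> U \<and> x - u \<in> W)"

text \<open>The operator \<open>S\<close> is dichotomous with respect to \<open>V = Vp \<oplus> Vm\<close>.\<close>

definition dichotomous_wrt ::
    "'a::complex_normed_vector operator \<Rightarrow> 'a set \<Rightarrow> 'a set \<Rightarrow> bool" where
  "dichotomous_wrt S Vp Vm \<longleftrightarrow> linear_operator UNIV S \<and> densely_defined UNIV S \<and>
     complementary_subspaces Vp Vm \<and>
     (\<exists>h>0. {z. \<bar>Re z\<bar> < h} \<subseteq> resolvent_set UNIV S) \<and>
     app S ` (dom S \<inter> Vp) \<subseteq> Vp \<and> app S ` (dom S \<inter> Vm) \<subseteq> Vm \<and>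
     spectrum Vp (restrict_operator S Vp) \<subseteq> {z. Re z > 0} \<and>
     spectrum Vm (restrict_operator S Vm) \<subseteq> {z. Re z < 0}"

definition sectorially_dichotomous :: "real \<Rightarrow> 'a::complex_normed_vector operator \<Rightarrow> bool" where
  "sectorially_dichotomous \<theta> S \<longleftrightarrow> 0 \<le> \<theta> \<and> \<theta> < pi / 2 \<and>
     (\<exists>Vp Vm. dichotomous_wrt S Vp Vm \<and>
        sectorial Vp \<theta> (restrict_operator S Vp) \<and>
        sectorial Vm \<theta> (neg_operator (restrict_operator S Vm)))"

text \<open>The line integral of \<open>f\<close> from \<open>- \<i> * \<rho>\<close> to \<open>\<i> * \<rho>\<close>, parametrised by \<open>z = \<i> * t\<close>.\<close>

definition imag_line_integral ::
    "real \<Rightarrow> (complex \<Rightarrow> 'a) \<Rightarrow> 'a::complex_normed_vector" where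
  "imag_line_integral \<rho> f = \<i> *\<^sub>C integral {-\<rho>..\<rho>} (\<lambda>t. f (\<i> * complex_of_real t))"

text \<open>
  A dichotomous operator may be dichotomous with respect to several decompositions. The
  decomposition meant for the Hamiltonian is the one whose projections are given by the
  principal value integral of the resolvent along the imaginary axis; the integral determines
  \<open>P\<^sub>+ - P\<^sub>-\<close> and hence the decomposition.
\<close>

definition dichotomy_decomposition ::
    "'a::complex_normed_vector operator \<Rightarrow> 'a set \<Rightarrow> 'a set \<Rightarrow> bool" where
  "dichotomy_decomposition S Vp Vm \<longleftrightarrow> dichotomous_wrt S Vp Vm \<and>
     (\<forall>x. ((\<lambda>\<rho>. (1 / (complex_of_real pi * \<i>)) *\<^sub>C
               imag_line_integral \<rho> (\<lambda>z. resolvent S z x))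
            \<longlongrightarrow> projection Vp Vm x - projection Vm Vp x) at_top)"


section \<open>Hamiltonian operator matrices\<close>

definition hamiltonian_entries ::
    "'h::complex_inner operator \<Rightarrow> 'h operator \<Rightarrow> 'h operator \<Rightarrow> bool" where
  "hamiltonian_entries A B C \<longleftrightarrow>
     linear_operator UNIV A \<and> densely_defined UNIV A \<and> closed_operator A \<and>
     linear_operator UNIV B \<and> densely_defined UNIV B \<and> symmetric_operator B \<and>
     linear_operator UNIV C \<and> densely_defined UNIV C \<and> symmetric_operator C"

text \<open>The operator given by the block matrix with rows \<open>(A, B)\<close> and \<open>(C, - A\<^sup>*)\<close>, on its natural
  domain.\<close>

definition hamiltonian ::
    "'h::complex_inner operator \<Rightarrow> 'h operator \<Rightarrow> 'h operator \<Rightarrow> ('h \<times> 'h) operator" where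
  "hamiltonian A B C = Operator
     ((dom A \<inter> dom C) \<times> (dom B \<inter> dom (adjoint_operator A)))
     (\<lambda>(x, y). (app A x + app B y, app C x - app (adjoint_operator A) y))"

definition diagonally_dominant ::
    "real \<Rightarrow> 'h::complex_inner operator \<Rightarrow> 'h operator \<Rightarrow> 'h operator \<Rightarrow> bool" where
  "diagonally_dominant p A B C \<longleftrightarrow>
     subordinate p C A \<and> subordinate p B (adjoint_operator A)"


section \<open>The indefinite inner products\<close>

definition J1 :: "'h::complex_inner \<times> 'h \<Rightarrow> 'h \<times> 'h" where
  "J1 = (\<lambda>(x, y). (- (\<i> *\<^sub>C y), \<i> *\<^sub>C x))"

definition J2 :: "'h::complex_inner \<times> 'h \<Rightarrow> 'h \<times> 'h" where
  "J2 = (\<lambda>(x, y). (y, x))"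

definition J_nonnegative :: "('a::complex_inner \<Rightarrow> 'a) \<Rightarrow> 'a set \<Rightarrow> bool" where
  "J_nonnegative J U \<longleftrightarrow> csubspace U \<and> (\<forall>x\<in>U. cinner (J x) x \<in> \<real>\<^sub>\<ge>\<^sub>0)"

definition J_nonpositive :: "('a::complex_inner \<Rightarrow> 'a) \<Rightarrow> 'a set \<Rightarrow> bool" where
  "J_nonpositive J U \<longleftrightarrow> csubspace U \<and> (\<forall>x\<in>U. cinner (J x) x \<in> \<real>\<^sub>\<le>\<^sub>0)"

definition hypermaximal_neutral :: "('a::complex_inner \<Rightarrow> 'a) \<Rightarrow> 'a set \<Rightarrow> bool" where
  "hypermaximal_neutral J U \<longleftrightarrow> csubspace U \<and> U = {x. \<forall>y\<in>U. cinner (J x) y = 0}"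

end

theory Submission
  imports Defs
begin

text \<open>
  The argument rests on how the Hamiltonian \<open>T\<close> behaves with respect to the two indefinite inner
  products: \<open>T\<close> is skew-symmetric for \<open>[_|_]\<^sub>1\<close>, because \<open>B\<close> and \<open>C\<close> are symmetric, and accretive
  for \<open>[_|_]\<^sub>2\<close>, because \<open>Re [T (u, v)|(u, v)]\<^sub>2 = (C u|u) + (B v|v)\<close>, which is nonnegative. For \<open>z\<close> on the imaginary
  axis both properties pass to \<open>T - z\<close> and from there to its inverse
  (\<open>skew_resolvent\<close>, \<open>accretive_resolvent\<close>). They survive integration along the
  imaginary axis and the limit, so \<open>Q = P\<^sub>+ - P\<^sub>-\<close> satisfies
  \<open>[Q x|y]\<^sub>1 = - [x|Q y]\<^sub>1\<close> and \<open>Re [Q x|x]\<^sub>2 \<ge> 0\<close>.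

  Now \<open>Q\<close> is the identity on \<open>V\<^sub>+\<close> and minus the identity on \<open>V\<^sub>-\<close>. The first relation therefore
  gives \<open>[x|y]\<^sub>1 = - [x|y]\<^sub>1\<close> for \<open>x\<close> and \<open>y\<close> in the same subspace, so both subspaces are neutral,
  and two complementary neutral subspaces are automatically hypermaximal, since the form is
  nondegenerate (\<open>complementary_neutral_hypermaximal\<close>). The second relation gives the sign of
  \<open>[x|x]\<^sub>2\<close> on either subspace.
\<close>

section \<open>Inner products\<close>

instance chilbert_space \<subseteq> banach ..

lemma cinner_add_right: "cinner x (y + z) = cinner x y + cinner (x::'a::complex_inner) z"
  by (metis cinner_add_left cinner_commute complex_cnj_add)

lemma cinner_scaleC_right: "cinner x (a *\<^sub>C y) = cnj a * cinner (x::'a::complex_inner) y"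
  by (metis cinner_scaleC_left cinner_commute complex_cnj_mult)

lemma scaleC_minus_one: "(-1) *\<^sub>C x = - (x::'a::complex_normed_vector)"
  using scaleC_of_real[of "-1" x] by simp

lemma cinner_minus_left: "cinner (- x) y = - cinner (x::'a::complex_inner) y"
  using cinner_scaleC_left[of "-1" x y] by (simp add: scaleC_minus_one)

lemma cinner_minus_right: "cinner x (- y) = - cinner (x::'a::complex_inner) y"
  using cinner_scaleC_right[of x "-1" y] by (simp add: scaleC_minus_one)

lemma cinner_diff_left: "cinner (x - y) z = cinner x z - cinner (y::'a::complex_inner) z"
  using cinner_add_left[of x "- y" z] by (simp add: cinner_minus_left)

lemma cinner_diff_right: "cinner x (y - z) = cinner x y - cinner (x::'a::complex_inner) z"
  using cinner_add_right[of x y "- z"] by (simp add: cinner_minus_right)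

lemma cinner_zero_left: "cinner 0 y = (0::complex)" for y :: "'a::complex_inner"
  using cinner_diff_left[of y y y] by simp

lemma cinner_zero_right: "cinner y 0 = (0::complex)" for y :: "'a::complex_inner"
  using cinner_diff_right[of y y y] by simp

lemma cinner_self_eq_0: "cinner x x = 0 \<longleftrightarrow> x = (0::'a::complex_inner)"
  by (simp add: cinner_self)

text \<open>The usual argument: the squared distance of \<open>x\<close> from its orthogonal projection onto the line
  through \<open>y\<close> is nonnegative.\<close>

lemma Cauchy_Schwarz: "cmod (cinner x y) \<le> norm x * norm (y::'a::complex_inner)"
proof (cases "y = 0")
  case True
  then show ?thesis by (simp add: cinner_zero_right)
next
  case False
  define c n where "c = cinner x y" and "n = (norm y)\<^sup>2"
  define a where "a = c / of_real n"
  have n: "n > 0" using False by (simp add: n_def)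
  have "complex_of_real ((norm (x - a *\<^sub>C y))\<^sup>2)
      = of_real ((norm x)\<^sup>2) - cnj a * c - a * cnj c + a * cnj a * of_real n"
    using cinner_self[of "x - a *\<^sub>C y"] cinner_self[of x] cinner_self[of y] cinner_commute[of y x]
    by (simp add: cinner_diff_left cinner_diff_right cinner_scaleC_left cinner_scaleC_right
        c_def n_def algebra_simps)
  also have "\<dots> = of_real ((norm x)\<^sup>2) - c * cnj c / of_real n"
    using n by (simp add: a_def field_simps)
  also have "\<dots> = of_real ((norm x)\<^sup>2 - (cmod c)\<^sup>2 / n)"
    by (simp flip: complex_norm_square)
  finally have "(norm (x - a *\<^sub>C y))\<^sup>2 = (norm x)\<^sup>2 - (cmod c)\<^sup>2 / n"
    using of_real_eq_iff by blast
  then have "(cmod c)\<^sup>2 / n \<le> (norm x)\<^sup>2"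
    by (metis diff_ge_0_iff_ge zero_le_power2)
  then have "(cmod c)\<^sup>2 \<le> (norm x * norm y)\<^sup>2"
    using n by (simp add: pos_divide_le_eq power_mult_distrib n_def)
  then show ?thesis
    unfolding c_def by (rule power2_le_imp_le) simp
qed

lemma bounded_linear_cinner_left: "bounded_linear (\<lambda>x. cinner x (y::'a::complex_inner))"
proof (rule bounded_linear_intro[where K = "norm y"])
  fix r :: real and x :: 'a
  show "cinner (r *\<^sub>R x) y = r *\<^sub>R cinner x y"
    by (simp add: cinner_scaleC_left scaleR_conv_of_real flip: scaleC_of_real)
qed (simp_all add: cinner_add_left Cauchy_Schwarz)

lemma bounded_linear_cinner_right: "bounded_linear (cinner (x::'a::complex_inner))"
proof (rule bounded_linear_intro[where K = "norm x"])
  fix r :: real and y :: 'a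
  show "cinner x (r *\<^sub>R y) = r *\<^sub>R cinner x y"
    by (simp add: cinner_scaleC_right scaleR_conv_of_real flip: scaleC_of_real)
qed (metis cinner_add_right, metis Cauchy_Schwarz mult.commute)

lemma orthogonal_dense_eq_0:
  fixes w :: "'a::complex_inner"
  assumes "UNIV \<subseteq> closure D" and "\<And>x. x \<in> D \<Longrightarrow> cinner x w = 0"
  shows "w = 0"
proof -
  have "closed {x. cinner x w = 0}"
    by (intro closed_Collect_eq linear_continuous_on bounded_linear_cinner_left continuous_on_const)
  then have "closure D \<subseteq> {x. cinner x w = 0}"
    using assms(2) by (intro closure_minimal) auto
  then show ?thesis
    using assms(1) cinner_self_eq_0[of w] by blast
qed

lemma cinner_adjoint_operator:
  assumes "densely_defined UNIV S" and "x \<in> dom S" and "y \<in> dom (adjoint_operator S)"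
  shows "cinner (app S x) y = cinner x (app (adjoint_operator S) y)"
proof -
  let ?P = "\<lambda>z. \<forall>x\<in>dom S. cinner (app S x) y = cinner x z"
  obtain z where z: "?P z"
    using assms(3) by (auto simp: adjoint_operator_def)
  have "z' = z" if "?P z'" for z'
  proof -
    have "z' - z = 0"
      using assms(1) that z
      by (intro orthogonal_dense_eq_0[of "dom S"]) (auto simp: cinner_diff_right densely_defined_def)
    then show ?thesis by simp
  qed
  then have "?P (THE z. ?P z)"
    using z by (rule theI[of ?P, rotated])
  then show ?thesis
    using assms(2) by (simp add: adjoint_operator_def)
qed


section \<open>The resolvent along the imaginary axis\<close>

lemma resolvent_in_dom:
  assumes "z \<in> resolvent_set UNIV S"
  shows "resolvent S z y \<in> dom S"
  using assms by (auto simp: resolvent_set_def resolvent_def bij_betw_def intro: inv_into_into)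

lemma app_resolvent:
  assumes "z \<in> resolvent_set UNIV S"
  shows "app S (resolvent S z y) = y + z *\<^sub>C resolvent S z y"
proof -
  have "app S (resolvent S z y) - z *\<^sub>C resolvent S z y = y"
    using assms unfolding resolvent_set_def resolvent_def bij_betw_def
    by (metis (mono_tags, lifting) UNIV_I f_inv_into_f mem_Collect_eq)
  then show ?thesis by (simp add: algebra_simps)
qed

lemma resolvent_app:
  assumes "z \<in> resolvent_set UNIV S" and "x \<in> dom S"
  shows "resolvent S z (app S x - z *\<^sub>C x) = x"
  using assms inv_into_f_f[of "\<lambda>x. app S x - z *\<^sub>C x" "dom S" x]
  by (simp add: resolvent_set_def resolvent_def bij_betw_def)

lemma resolvent_diff:
  assumes "linear_operator UNIV S" and "z \<in> resolvent_set UNIV S" and "w \<in> resolvent_set UNIV S"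
  shows "resolvent S z y - resolvent S w y = resolvent S w ((z - w) *\<^sub>C resolvent S z y)"
proof -
  let ?u = "resolvent S z y" and ?v = "resolvent S w y"
  have dom: "?u \<in> dom S" "- ?v \<in> dom S"
    using assms(1) resolvent_in_dom[OF assms(2), of y]
      complex_vs.subspace_neg[OF _ resolvent_in_dom[OF assms(3), of y]]
    by (simp_all add: linear_operator_def)
  then have uv: "?u - ?v \<in> dom S"
    using assms(1) complex_vs.subspace_add[of "dom S" ?u "- ?v"] by (simp add: linear_operator_def)
  have "app S (- ?v) = - app S ?v"
    using assms(1) resolvent_in_dom[OF assms(3), of y]
    by (metis linear_operator_def scaleC_minus_one)
  then have "app S (?u - ?v) = app S ?u - app S ?v"
    using assms(1) dom by (metis linear_operator_def diff_conv_add_uminus)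
  then have "app S (?u - ?v) - w *\<^sub>C (?u - ?v) = (z - w) *\<^sub>C ?u"
    using assms
    by (simp add: app_resolvent complex_vs.scale_left_diff_distrib
        complex_vs.scale_right_diff_distrib)
  then show ?thesis
    using resolvent_app[OF assms(3) uv] by simp
qed

text \<open>If \<open>K\<close> bounds the resolvent at \<open>w\<close>, the resolvent identity bounds it by \<open>2 K\<close> at all \<open>z\<close>
  with \<open>\<bar>z - w\<bar> K \<le> 1/2\<close>, and a second use of the identity makes it Lipschitz at \<open>w\<close>.\<close>

lemma resolvent_continuous_on:
  assumes "linear_operator UNIV S" and "Z \<subseteq> resolvent_set UNIV S"
  shows "continuous_on Z (\<lambda>z. resolvent S z y)"
  unfolding continuous_on_def
proof
  fix w assume w: "w \<in> Z"
  then obtain K0 where K0: "norm (resolvent S w y) \<le> K0 * norm y" for y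
    using assms(2) unfolding resolvent_set_def by blast
  define K where "K = max K0 1"
  have K: "norm (resolvent S w y) \<le> K * norm y" for y
    using K0[of y] mult_right_mono[of K0 K "norm y"] by (simp add: K_def)
  have K1: "K \<ge> 1" by (simp add: K_def)
  have bound: "norm (resolvent S z y - resolvent S w y) \<le> 2 * K * K * norm y * cmod (z - w)"
    if z: "z \<in> Z" and close: "cmod (z - w) * K \<le> 1 / 2" for z
  proof -
    have d: "norm (resolvent S z y - resolvent S w y) \<le> K * (cmod (z - w) * norm (resolvent S z y))"
      using K[of "(z - w) *\<^sub>C resolvent S z y"] w z assms(2)
      by (subst resolvent_diff[OF assms(1)]) (auto simp: norm_scaleC)
    have "\<dots> \<le> 1 / 2 * norm (resolvent S z y)"
      using mult_right_mono[OF close norm_ge_zero[of "resolvent S z y"]]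
      by (simp add: mult.commute mult.left_commute)
    with d have "norm (resolvent S z y) \<le> 2 * (K * norm y)"
      using K[of y] norm_triangle_ineq2[of "resolvent S z y" "resolvent S w y"] by linarith
    then have "K * (cmod (z - w) * norm (resolvent S z y))
        \<le> K * (cmod (z - w) * (2 * (K * norm y)))"
      using K1 by (intro mult_left_mono) auto
    with d show ?thesis by (simp add: mult_ac)
  qed
  have "((\<lambda>z. resolvent S z y - resolvent S w y) \<longlongrightarrow> 0) (at w within Z)"
  proof (rule Lim_null_comparison)
    have "\<forall>\<^sub>F z in at w within Z. z \<in> Z \<and> dist z w < 1 / (2 * K)"
      unfolding eventually_at using K1 by (intro exI[of _ "1 / (2 * K)"]) auto
    then show "\<forall>\<^sub>F z in at w within Z.
        norm (resolvent S z y - resolvent S w y) \<le> 2 * K * K * norm y * cmod (z - w)"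
    proof (rule eventually_mono)
      fix z assume z: "z \<in> Z \<and> dist z w < 1 / (2 * K)"
      then have "cmod (z - w) * K \<le> 1 / 2"
        using K1 by (simp add: dist_norm field_simps)
      then show "norm (resolvent S z y - resolvent S w y) \<le> 2 * K * K * norm y * cmod (z - w)"
        using bound z by blast
    qed
    show "((\<lambda>z. 2 * K * K * norm y * cmod (z - w)) \<longlongrightarrow> 0) (at w within Z)"
      by (intro tendsto_mult_right_zero tendsto_norm_zero LIM_zero tendsto_ident_at)
  qed
  then show "((\<lambda>z. resolvent S z y) \<longlongrightarrow> resolvent S w y) (at w within Z)"
    by (rule Lim_null[THEN iffD2])
qed

text \<open>For a dichotomy decomposition of \<open>S\<close>, this is the truncated integral whose limit
  for \<open>\<rho> \<rightarrow> \<infinity>\<close> is \<open>P\<^sub>+ - P\<^sub>-\<close>.\<close>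

definition resolvent_average :: "'a::complex_normed_vector operator \<Rightarrow> real \<Rightarrow> 'a \<Rightarrow> 'a" where
  "resolvent_average S \<rho> x =
     (1 / (complex_of_real pi * \<i>)) *\<^sub>C imag_line_integral \<rho> (\<lambda>z. resolvent S z x)"

lemma resolvent_average_eq:
  "resolvent_average S \<rho> x =
     (1 / pi) *\<^sub>R integral {-\<rho>..\<rho>} (\<lambda>t. resolvent S (\<i> * complex_of_real t) x)"
  by (simp add: resolvent_average_def imag_line_integral_def scaleC_scaleC flip: scaleC_of_real)

text \<open>Continuity of the resolvent makes the integrand integrable, so the integral in
  \<open>resolvent_average\<close> is not the default value \<open>0\<close> and commutes with bounded functionals. This
  reduces statements about it to pointwise ones about the resolvent.\<close>

lemma resolvent_average_functional:
  fixes S :: "'a::chilbert_space operator" and f :: "'a \<Rightarrow> complex"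
  assumes "linear_operator UNIV S" and "{z. Re z = 0} \<subseteq> resolvent_set UNIV S"
    and f: "bounded_linear f"
  shows "((\<lambda>t. f (resolvent S (\<i> * complex_of_real t) x)) has_integral
           (of_real pi * f (resolvent_average S \<rho> x))) {-\<rho>..\<rho>}"
proof -
  interpret f: bounded_linear f by (rule f)
  let ?g = "\<lambda>t. resolvent S (\<i> * complex_of_real t) x"
  have "continuous_on {-\<rho>..\<rho>} ?g"
    by (rule continuous_on_compose2[OF resolvent_continuous_on[OF assms(1,2)]])
      (auto intro!: continuous_intros)
  then have "?g integrable_on {-\<rho>..\<rho>}"
    by (rule integrable_continuous_interval)
  then have "((\<lambda>t. f (?g t)) has_integral f (integral {-\<rho>..\<rho>} ?g)) {-\<rho>..\<rho>}"
    using has_integral_linear[OF integrable_integral f] by (simp add: o_def)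
  moreover have "of_real pi * f (resolvent_average S \<rho> x) = f (integral {-\<rho>..\<rho>} ?g)"
    by (simp add: resolvent_average_eq f.scaleR scaleR_conv_of_real)
  ultimately show ?thesis by simp
qed

lemma dichotomy_decomposition_resolvent_average:
  assumes "dichotomy_decomposition S Vp Vm"
  shows "x \<in> Vp \<Longrightarrow> ((\<lambda>\<rho>. resolvent_average S \<rho> x) \<longlongrightarrow> x) at_top"
    and "x \<in> Vm \<Longrightarrow> ((\<lambda>\<rho>. resolvent_average S \<rho> x) \<longlongrightarrow> - x) at_top"
proof -
  have comp: "csubspace Vp" "csubspace Vm" "Vp \<inter> Vm = {0}"
    and lim: "((\<lambda>\<rho>. resolvent_average S \<rho> x) \<longlongrightarrow> projection Vp Vm x - projection Vm Vp x) at_top"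
      for x
    using assms
    by (auto simp: dichotomy_decomposition_def dichotomous_wrt_def complementary_subspaces_def
        resolvent_average_def)
  have proj: "projection U W x = x \<and> projection W U x = 0"
    if "csubspace U" "csubspace W" "U \<inter> W = {0}" "x \<in> U" for U W :: "'a set" and x
  proof -
    have "u = x" if u: "u \<in> U" "x - u \<in> W" for u
    proof -
      have "x - u \<in> U"
        by (rule complex_vs.subspace_diff[OF \<open>csubspace U\<close> \<open>x \<in> U\<close> u(1)])
      then have "x - u \<in> {0}" using u(2) \<open>U \<inter> W = {0}\<close> by blast
      then show ?thesis by simp
    qed
    moreover have "u = 0" if u: "u \<in> W" "x - u \<in> U" for u
    proof -
      have "x - (x - u) \<in> U"
        by (rule complex_vs.subspace_diff[OF \<open>csubspace U\<close> \<open>x \<in> U\<close> u(2)])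
      then have "u \<in> U" by simp
      then have "u \<in> {0}" using u(1) \<open>U \<inter> W = {0}\<close> by blast
      then show ?thesis by simp
    qed
    ultimately show ?thesis
      unfolding projection_def
      using that complex_vs.subspace_0[OF \<open>csubspace W\<close>]
      by (intro conjI the_equality) auto
  qed
  show "((\<lambda>\<rho>. resolvent_average S \<rho> x) \<longlongrightarrow> x) at_top" if "x \<in> Vp"
    using lim[of x] proj[OF comp that] by simp
  show "((\<lambda>\<rho>. resolvent_average S \<rho> x) \<longlongrightarrow> - x) at_top" if "x \<in> Vm"
    using lim[of x] proj[OF comp(2,1) _ that] comp(3) by (simp add: Int_commute)
qed


lemma complementary_subspaces_commute:
  assumes "complementary_subspaces U W"
  shows "complementary_subspaces W U"
proof -
  have "{w + u | w u. w \<in> W \<and> u \<in> U} = {u + w | u w. u \<in> U \<and> w \<in> W}"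
    by (intro Collect_cong) (metis add.commute)
  then show ?thesis
    using assms by (simp add: complementary_subspaces_def Int_commute)
qed


section \<open>Operators that are skew-symmetric or accretive for an indefinite inner product\<close>

text \<open>A fundamental symmetry is self-adjoint and unitary: the first makes the form hermitian, the
  isometry makes it nondegenerate.\<close>

locale fundamental_symmetry =
  fixes J :: "'a::chilbert_space \<Rightarrow> 'a"
  assumes J_add: "J (x + y) = J x + J y"
    and J_scaleC: "J (a *\<^sub>C x) = a *\<^sub>C J x"
    and J_norm: "norm (J x) = norm x"
    and J_hermitian: "cinner (J x) y = cinner x (J y)"
begin

definition form :: "'a \<Rightarrow> 'a \<Rightarrow> complex" where
  "form x y = cinner (J x) y"

lemma form_add: "form (x + y) w = form x w + form y w" "form x (y + w) = form x y + form x w"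
  by (simp_all add: form_def J_add cinner_add_left cinner_add_right)

lemma form_scaleC: "form (a *\<^sub>C x) y = a * form x y" "form x (a *\<^sub>C y) = cnj a * form x y"
  by (simp_all add: form_def J_scaleC cinner_scaleC_left cinner_scaleC_right)

lemma form_commute: "form x y = cnj (form y x)"
  unfolding form_def by (metis J_hermitian cinner_commute)

lemma bounded_linear_form_right: "bounded_linear (form x)"
  unfolding form_def by (rule bounded_linear_cinner_right)

lemma bounded_linear_form_left: "bounded_linear (\<lambda>x. form x y)"
  unfolding form_def J_hermitian by (rule bounded_linear_cinner_left)

lemma form_nondegenerate:
  assumes "\<And>y. form x y = 0"
  shows "x = 0"
  using assms[of "J x"] J_norm[of x] by (simp add: form_def cinner_self_eq_0)

lemma form_self_Re: "form x x = of_real (Re (form x x))"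
  using form_commute[of x x] by (simp add: complex_eq_iff)

lemma complementary_neutral_hypermaximal:
  assumes "complementary_subspaces U W"
    and U: "\<And>x y. x \<in> U \<Longrightarrow> y \<in> U \<Longrightarrow> form x y = 0"
    and W: "\<And>x y. x \<in> W \<Longrightarrow> y \<in> W \<Longrightarrow> form x y = 0"
  shows "hypermaximal_neutral J U"
proof -
  have sum: "\<exists>u w. u \<in> U \<and> w \<in> W \<and> x = u + w" for x
    using assms(1) unfolding complementary_subspaces_def by blast
  have "x \<in> U" if x: "\<And>y. y \<in> U \<Longrightarrow> form x y = 0" for x
  proof -
    obtain u w where uw: "u \<in> U" "w \<in> W" "x = u + w" using sum by blast
    \<comment> \<open>The component \<open>w\<close> is orthogonal to \<open>U\<close> along with \<open>x\<close> and \<open>u\<close>, and to \<open>W\<close> by neutrality.\<close>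
    have "form w y = 0" for y
    proof -
      obtain u' w' where y: "u' \<in> U" "w' \<in> W" "y = u' + w'" using sum by blast
      show ?thesis
        using x[OF y(1)] U[OF uw(1) y(1)] W[OF uw(2) y(2)] by (simp add: form_add uw(3) y(3))
    qed
    then show ?thesis
      using form_nondegenerate[of w] uw by simp
  qed
  then show ?thesis
    using assms(1) U by (auto simp: hypermaximal_neutral_def complementary_subspaces_def form_def)
qed

text \<open>For \<open>u = (S - z)\<^sup>-\<^sup>1 x\<close> and \<open>v = (S - z)\<^sup>-\<^sup>1 y\<close> the claim is
  \<open>[u|(S - z) v] = - [(S - z) u|v]\<close>, which holds for \<open>S\<close> by assumption and for \<open>z\<close> because
  \<open>cnj z = - z\<close>.\<close>

lemma skew_resolvent:
  assumes "z \<in> resolvent_set UNIV S" and "Re z = 0"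
    and skew: "\<And>x y. x \<in> dom S \<Longrightarrow> y \<in> dom S \<Longrightarrow> form (app S x) y = - form x (app S y)"
  shows "form (resolvent S z x) y = - form x (resolvent S z y)"
proof -
  have "cnj z = - z" using assms(2) by (simp add: complex_eq_iff)
  then show ?thesis
    using skew[OF resolvent_in_dom resolvent_in_dom, OF assms(1,1), of x y]
    by (simp add: app_resolvent[OF assms(1)] form_add form_scaleC)
qed

text \<open>With \<open>u = (S - z)\<^sup>-\<^sup>1 x\<close> one has \<open>[x|u] = [S u|u] - z [u|u]\<close>, where the last term is purely
  imaginary.\<close>

lemma accretive_resolvent:
  assumes "z \<in> resolvent_set UNIV S" and "Re z = 0"
    and accretive: "\<And>x. x \<in> dom S \<Longrightarrow> 0 \<le> Re (form (app S x) x)"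
  shows "0 \<le> Re (form (resolvent S z x) x)"
proof -
  let ?u = "resolvent S z x"
  have "Re (z * form ?u ?u) = 0"
    by (subst form_self_Re) (simp add: assms(2))
  moreover have "form (app S ?u) ?u = form x ?u + z * form ?u ?u"
    by (simp add: app_resolvent[OF assms(1)] form_add form_scaleC)
  ultimately have "Re (form (app S ?u) ?u) = Re (form ?u x)"
    using form_commute[of x ?u] by simp
  then show ?thesis
    using accretive[OF resolvent_in_dom[OF assms(1)]] by metis
qed

lemma skew_resolvent_average:
  assumes "linear_operator UNIV S" and iR: "{z. Re z = 0} \<subseteq> resolvent_set UNIV S"
    and skew: "\<And>x y. x \<in> dom S \<Longrightarrow> y \<in> dom S \<Longrightarrow> form (app S x) y = - form x (app S y)"
  shows "form (resolvent_average S \<rho> x) y = - form x (resolvent_average S \<rho> y)"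
proof -
  let ?R = "\<lambda>t. resolvent S (\<i> * complex_of_real t)"
  have eq: "form (?R t x) y = - form x (?R t y)" for t
    using iR skew by (intro skew_resolvent) auto
  have "((\<lambda>t. form (?R t x) y) has_integral of_real pi * form (resolvent_average S \<rho> x) y) {-\<rho>..\<rho>}"
    using resolvent_average_functional[OF assms(1,2) bounded_linear_form_left] .
  moreover have "((\<lambda>t. - form x (?R t y)) has_integral
      - (of_real pi * form x (resolvent_average S \<rho> y))) {-\<rho>..\<rho>}"
    using has_integral_neg[OF resolvent_average_functional[OF assms(1,2) bounded_linear_form_right]] .
  ultimately have "of_real pi * form (resolvent_average S \<rho> x) y
      = - (of_real pi * form x (resolvent_average S \<rho> y))"
    unfolding eq by (rule has_integral_unique)
  then have "of_real pi * form (resolvent_average S \<rho> x) y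
      = of_real pi * - form x (resolvent_average S \<rho> y)"
    by simp
  then show ?thesis by (metis mult_cancel_left of_real_eq_0_iff pi_neq_zero)
qed

lemma accretive_resolvent_average:
  assumes "linear_operator UNIV S" and iR: "{z. Re z = 0} \<subseteq> resolvent_set UNIV S"
    and accretive: "\<And>x. x \<in> dom S \<Longrightarrow> 0 \<le> Re (form (app S x) x)"
  shows "0 \<le> Re (form (resolvent_average S \<rho> x) x)"
proof -
  let ?R = "\<lambda>t. resolvent S (\<i> * complex_of_real t)"
  have "((\<lambda>t. Re (form (?R t x) x)) has_integral
      Re (of_real pi * form (resolvent_average S \<rho> x) x)) {-\<rho>..\<rho>}"
    using has_integral_linear[OF
        resolvent_average_functional[OF assms(1,2) bounded_linear_form_left] bounded_linear_Re]
    by (simp add: o_def)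
  moreover have "0 \<le> Re (form (?R t x) x)" for t
    using iR accretive by (intro accretive_resolvent) auto
  ultimately have "0 \<le> Re (of_real pi * form (resolvent_average S \<rho> x) x)"
    by (rule has_integral_nonneg)
  then show ?thesis using pi_gt_zero by (simp add: zero_le_mult_iff)
qed

lemma dichotomy_imaginary_axis:
  assumes "dichotomy_decomposition S Vp Vm"
  shows "linear_operator UNIV S" and "{z. Re z = 0} \<subseteq> resolvent_set UNIV S"
  using assms by (force simp: dichotomy_decomposition_def dichotomous_wrt_def)+

text \<open>Here \<open>P\<^sub>+ - P\<^sub>-\<close> is skew-symmetric for the form as a limit of skew-symmetric operators, whereas
  on each of the two subspaces it is plus or minus the identity, which is symmetric.\<close>

theorem skew_dichotomy_hypermaximal_neutral:
  assumes dec: "dichotomy_decomposition S Vp Vm"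
    and skew: "\<And>x y. x \<in> dom S \<Longrightarrow> y \<in> dom S \<Longrightarrow> form (app S x) y = - form x (app S y)"
  shows "hypermaximal_neutral J Vp" and "hypermaximal_neutral J Vm"
proof -
  note lim = dichotomy_decomposition_resolvent_average[OF dec]
  have limits: "form x' y = - form x y'"
    if "((\<lambda>\<rho>. resolvent_average S \<rho> x) \<longlongrightarrow> x') at_top"
      and "((\<lambda>\<rho>. resolvent_average S \<rho> y) \<longlongrightarrow> y') at_top" for x y x' y'
  proof -
    have "((\<lambda>\<rho>. form (resolvent_average S \<rho> x) y) \<longlongrightarrow> form x' y) at_top"
      by (rule bounded_linear.tendsto[OF bounded_linear_form_left that(1)])
    moreover have "((\<lambda>\<rho>. - form x (resolvent_average S \<rho> y)) \<longlongrightarrow> - form x y') at_top"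
      by (intro tendsto_minus bounded_linear.tendsto[OF bounded_linear_form_right that(2)])
    moreover have "form (resolvent_average S \<rho> x) y = - form x (resolvent_average S \<rho> y)" for \<rho>
      by (rule skew_resolvent_average[OF dichotomy_imaginary_axis[OF dec] skew])
    ultimately show ?thesis
      by (simp add: tendsto_unique[OF trivial_limit_at_top_linorder])
  qed
  have p: "form x y = 0" if "x \<in> Vp" "y \<in> Vp" for x y
    using limits[OF lim(1)[OF that(1)] lim(1)[OF that(2)]] by simp
  have m: "form x y = 0" if "x \<in> Vm" "y \<in> Vm" for x y
    using limits[OF lim(2)[OF that(1)] lim(2)[OF that(2)]]
    by (simp add: form_def cinner_minus_right J_hermitian cinner_minus_left)
  have comp: "complementary_subspaces Vp Vm"
    using dec by (simp add: dichotomy_decomposition_def dichotomous_wrt_def)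
  then have "complementary_subspaces Vm Vp"
    by (rule complementary_subspaces_commute)
  with comp show "hypermaximal_neutral J Vp" "hypermaximal_neutral J Vm"
    using p m by (auto intro: complementary_neutral_hypermaximal)
qed

text \<open>Here \<open>P\<^sub>+ - P\<^sub>-\<close> is accretive for the form, and \<open>[x|x]\<close> and \<open>- [x|x]\<close> are the values of
  \<open>[(P\<^sub>+ - P\<^sub>-) x|x]\<close> on the two subspaces.\<close>

theorem accretive_dichotomy_definite:
  assumes dec: "dichotomy_decomposition S Vp Vm"
    and accretive: "\<And>x. x \<in> dom S \<Longrightarrow> 0 \<le> Re (form (app S x) x)"
  shows "J_nonnegative J Vp" and "J_nonpositive J Vm"
proof -
  have limit: "0 \<le> Re (form x' x)"
    if "((\<lambda>\<rho>. resolvent_average S \<rho> x) \<longlongrightarrow> x') at_top" for x x'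
  proof (rule tendsto_lowerbound[OF _ _ trivial_limit_at_top_linorder])
    show "((\<lambda>\<rho>. Re (form (resolvent_average S \<rho> x) x)) \<longlongrightarrow> Re (form x' x)) at_top"
      by (intro tendsto_Re bounded_linear.tendsto[OF bounded_linear_form_left that])
    show "\<forall>\<^sub>F \<rho> in at_top. 0 \<le> Re (form (resolvent_average S \<rho> x) x)"
      using accretive_resolvent_average[OF dichotomy_imaginary_axis[OF dec] accretive] by simp
  qed
  note lim = dichotomy_decomposition_resolvent_average[OF dec]
  have "form x x \<in> \<real>\<^sub>\<ge>\<^sub>0" if "x \<in> Vp" for x
    using limit[OF lim(1)[OF that]] by (subst form_self_Re) simp
  moreover have "form x x \<in> \<real>\<^sub>\<le>\<^sub>0" if "x \<in> Vm" for x
    using limit[OF lim(2)[OF that]]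
    by (subst form_self_Re) (simp add: form_def J_hermitian cinner_minus_left)
  moreover have "csubspace Vp" "csubspace Vm"
    using dec
    by (auto simp: dichotomy_decomposition_def dichotomous_wrt_def complementary_subspaces_def)
  ultimately show "J_nonnegative J Vp" "J_nonpositive J Vm"
    by (auto simp: J_nonnegative_def J_nonpositive_def form_def)
qed

end


section \<open>Hamiltonians\<close>

interpretation J1: fundamental_symmetry "J1 :: 'h::chilbert_space \<times> 'h \<Rightarrow> 'h \<times> 'h"
proof
  fix x y :: "'h \<times> 'h" and a :: complex
  show "J1 (x + y) = J1 x + J1 y"
    by (simp add: J1_def case_prod_beta scaleC_add_right)
  show "J1 (a *\<^sub>C x) = a *\<^sub>C J1 x"
    by (simp add: J1_def case_prod_beta scaleC_prod_def scaleC_scaleC mult.commute)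
  show "norm (J1 x) = norm x"
    by (simp add: J1_def case_prod_beta norm_prod_def norm_scaleC add.commute)
  show "cinner (J1 x) y = cinner x (J1 y)"
    by (simp add: J1_def case_prod_beta cinner_prod_def cinner_minus_left cinner_minus_right
        cinner_scaleC_left cinner_scaleC_right)
qed

interpretation J2: fundamental_symmetry "J2 :: 'h::chilbert_space \<times> 'h \<Rightarrow> 'h \<times> 'h"
proof
  fix x y :: "'h \<times> 'h" and a :: complex
  show "J2 (x + y) = J2 x + J2 y"
    by (simp add: J2_def case_prod_beta)
  show "J2 (a *\<^sub>C x) = a *\<^sub>C J2 x"
    by (simp add: J2_def case_prod_beta scaleC_prod_def)
  show "norm (J2 x) = norm x"
    by (simp add: J2_def case_prod_beta norm_prod_def add.commute)
  show "cinner (J2 x) y = cinner x (J2 y)"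
    by (simp add: J2_def case_prod_beta cinner_prod_def)
qed

lemma J1_form: "J1.form (u, v) (u', v') = \<i> * (cinner u v' - cinner v u')"
  unfolding J1.form_def
  by (simp add: J1_def cinner_prod_def cinner_minus_left cinner_scaleC_left algebra_simps)

lemma J2_form: "J2.form (u, v) (u', v') = cinner u v' + cinner v u'"
  unfolding J2.form_def by (simp add: J2_def cinner_prod_def)

text \<open>The terms with \<open>B\<close> and those with \<open>C\<close> cancel by symmetry, the terms with \<open>A\<close> cancel
  against those with \<open>A\<^sup>*\<close>.\<close>

lemma hamiltonian_skew:
  fixes A B C :: "'h::chilbert_space operator"
  assumes "hamiltonian_entries A B C"
    and "x \<in> dom (hamiltonian A B C)" and "y \<in> dom (hamiltonian A B C)"
  shows "J1.form (app (hamiltonian A B C) x) y = - J1.form x (app (hamiltonian A B C) y)"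
proof -
  obtain u v u' v' where xy: "x = (u, v)" "y = (u', v')" by fastforce
  let ?A' = "adjoint_operator A"
  have dom: "u \<in> dom A" "u \<in> dom C" "v \<in> dom B" "v \<in> dom ?A'"
    "u' \<in> dom A" "u' \<in> dom C" "v' \<in> dom B" "v' \<in> dom ?A'"
    using assms(2,3) by (simp_all add: hamiltonian_def xy)
  have dense: "densely_defined UNIV A"
    and "cinner (app B v) v' = cinner v (app B v')" "cinner (app C u) u' = cinner u (app C u')"
    using assms(1) dom by (auto simp: hamiltonian_entries_def symmetric_operator_def)
  moreover have "cinner (app A u) v' = cinner u (app ?A' v')"
    using cinner_adjoint_operator[OF dense] dom by blast
  moreover have "cinner (app ?A' v) u' = cinner v (app A u')"
    using cinner_adjoint_operator[OF dense dom(5,4)] cinner_commute by metis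
  ultimately show ?thesis
    by (simp add: J1_form hamiltonian_def xy cinner_add_left cinner_add_right cinner_diff_left
        cinner_diff_right algebra_simps)
qed

text \<open>For \<open>x = (u, v)\<close> the form is \<open>(A u|v) - (A\<^sup>* v|u) + (B v|v) + (C u|u)\<close>, in which the first
  two terms have a purely imaginary difference.\<close>

lemma hamiltonian_accretive:
  fixes A B C :: "'h::chilbert_space operator"
  assumes "hamiltonian_entries A B C" and "nonnegative_operator B" and "nonnegative_operator C"
    and "x \<in> dom (hamiltonian A B C)"
  shows "0 \<le> Re (J2.form (app (hamiltonian A B C) x) x)"
proof -
  obtain u v where x: "x = (u, v)" by fastforce
  let ?A' = "adjoint_operator A"
  have dom: "u \<in> dom A" "u \<in> dom C" "v \<in> dom B" "v \<in> dom ?A'"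
    using assms(4) by (simp_all add: hamiltonian_def x)
  have "cinner (app A u) v = cinner u (app ?A' v)"
    using cinner_adjoint_operator assms(1) dom by (auto simp: hamiltonian_entries_def)
  then have "Re (cinner (app A u) v) = Re (cinner (app ?A' v) u)"
    using cinner_commute[of u "app ?A' v"] by simp
  moreover have "0 \<le> Re (cinner (app B v) v)" "0 \<le> Re (cinner (app C u) u)"
    using assms(2,3) dom by (auto simp: nonnegative_operator_def complex_nonneg_Reals_iff)
  ultimately show ?thesis
    by (simp add: J2_form hamiltonian_def x cinner_add_left cinner_diff_left)
qed

theorem corollary4p9:
  fixes A B C :: "'h::chilbert_space operator"
    and p \<theta> :: real
    and Vp Vm :: "('h \<times> 'h) set"
  assumes "hamiltonian_entries A B C"
    and "nonnegative_operator B" and "nonnegative_operator C"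
    and "diagonally_dominant p A B C" and "p < 1"
    and "sectorially_dichotomous \<theta> A"
    and "dichotomy_decomposition (hamiltonian A B C) Vp Vm"
  shows "hypermaximal_neutral J1 Vp \<and> hypermaximal_neutral J1 Vm \<and>
         J_nonnegative J2 Vp \<and> J_nonpositive J2 Vm"
  using J1.skew_dichotomy_hypermaximal_neutral[OF assms(7) hamiltonian_skew[OF assms(1)]]
    J2.accretive_dichotomy_definite[OF assms(7) hamiltonian_accretive[OF assms(1-3)]]
  by blast

end
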